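(* (Non-local Korn's inequality.) Let $n\in\{2,3\}$ and let $\Omega\subset\mathbb{R}^n$ be a bounded open connected set with Lipschitz boundary. Let $A\in L^2(\Omega\times\Omega)$ be a symmetric, strictly positive definite kernel whose weak first partial derivatives are in $L^1_{loc}(\Omega\times\Omega)$. Assume in addition that there is a constant $\gamma$ with $\gamma^2=1$ such that, for every $k=1,\dots,n$, $$\partial_{x_k}A(x,x')=\gamma\,\partial_{x'_k}A(x,x')\quad\text{for a.e. }(x,x')\in\Omega\times\Omega .$$ Then for all $u\in V_A$, $$2\int_\Omega\int_\Omega A(x,x')\,\varepsilon_u(x):\varepsilon_u(x')\,dx'\,dx\ \ge\ (u,u)_A .$$
   Context: $\alpha:\beta=\sum_{k,m}\alpha_{km}\beta_{km}$ is the Frobenius product on $n\times n$ matrices, and $\varepsilon_u=\tfrac12[\nabla u+(\nabla u)^{\mathrm T}]$. A kernel $A\in L^1(\Omega\times\Omega)$ is symmetric if $A(x,x')=A(x',x)$ a.e., and strictly positive definite if $\int_\Omega\int_\Omega A(x,x')\phi(x)\phi(x')\,dx'\,dx>0$ for all $\phi\in C_c^\infty(\Omega)\setminus\{0\}$ (real-valued $\phi$). For such $A$, $(u,v)_A=\int_\Omega\int_\Omega A(x,x')\,\nabla u(x):\nabla v(x')\,dx'\,dx$ is an inner product on $C_c^\infty(\Omega;\mathbb{R}^n)$ with induced norm $\|\cdot\|_A$, and $V_A$ is the Hilbert space completion of $C_c^\infty(\Omega;\mathbb{R}^n)$ with respect to it. For $A\in L^2(\Omega\times\Omega)$ the form $(u,v)\mapsto\int_\Omega\int_\Omega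 A(x,x')\,\varepsilon_u(x):\varepsilon_v(x')\,dx'\,dx$ on $C_c^\infty(\Omega;\mathbb{R}^n)$ is bounded in absolute value by $\|u\|_A\|v\|_A$; for $u\in V_A$ the left-hand side of the inequality is understood as the extension of this form by continuity. *)

theory Defs
  imports "HOL-Analysis.Analysis"
begin

primrec C_diff :: "nat \<Rightarrow> ('a::euclidean_space \<Rightarrow> 'b::real_normed_vector) \<Rightarrow> bool" where
  "C_diff 0 f \<longleftrightarrow> continuous_on UNIV f"
| "C_diff (Suc m) f \<longleftrightarrow> (\<forall>x. f differentiable at x) \<and>
     (\<forall>v. C_diff m (\<lambda>x. frechet_derivative f (at x) v))"

text \<open>Compactly supported smooth functions on an open set \<open>U\<close> are represented by their
  extensions by zero to the whole space.\<close>

definition test_functions ::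
    "'a::euclidean_space set \<Rightarrow> ('a \<Rightarrow> 'b::real_normed_vector) set" where
  "test_functions U =
     {f. (\<forall>m. C_diff m f) \<and> compact (closure {x. f x \<noteq> 0}) \<and> closure {x. f x \<noteq> 0} \<subseteq> U}"

definition locally_integrable_on :: "('a::euclidean_space \<Rightarrow> real) \<Rightarrow> 'a set \<Rightarrow> bool" where
  "locally_integrable_on f U \<longleftrightarrow> (\<forall>K. compact K \<and> K \<subseteq> U \<longrightarrow> set_integrable lebesgue K f)"

definition weak_partial_derivative ::
    "'a::euclidean_space set \<Rightarrow> 'a \<Rightarrow> ('a \<Rightarrow> real) \<Rightarrow> ('a \<Rightarrow> real) \<Rightarrow> bool" where
  "weak_partial_derivative U e f g \<longleftrightarrow>
     locally_integrable_on f U \<and> locally_integrable_on g U \<and>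
     (\<forall>\<phi>\<in>test_functions U.
        (LINT z:U|lebesgue. f z * frechet_derivative \<phi> (at z) e) =
        - (LINT z:U|lebesgue. g z * \<phi> z))"

definition square_integrable_on :: "('a::euclidean_space \<Rightarrow> real) \<Rightarrow> 'a set \<Rightarrow> bool" where
  "square_integrable_on f S \<longleftrightarrow>
     f \<in> borel_measurable (lebesgue_on S) \<and> integrable (lebesgue_on S) (\<lambda>z. (f z)\<^sup>2)"

text \<open>Near each boundary point the set is, in suitable orthonormal coordinates, the part lying
  above the graph of a Lipschitz function. The unit vector \<open>\<nu>\<close> is the last coordinate direction,
  and \<open>x - (x \<bullet> \<nu>) *\<^sub>R \<nu>\<close> is the projection of \<open>x\<close> to the hyperplane of the remaining
  coordinates, on which the graph function \<open>g\<close> is Lipschitz.\<close>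

definition lipschitz_boundary :: "'a::euclidean_space set \<Rightarrow> bool" where
  "lipschitz_boundary \<Omega> \<longleftrightarrow>
     (\<forall>p\<in>frontier \<Omega>. \<exists>r>0. \<exists>\<nu> g L. norm \<nu> = 1 \<and> L-lipschitz_on {y. y \<bullet> \<nu> = 0} g \<and>
        \<Omega> \<inter> ball p r = {x \<in> ball p r. g (x - (x \<bullet> \<nu>) *\<^sub>R \<nu>) < x \<bullet> \<nu>})"

definition symmetric_kernel :: "'a::euclidean_space set \<Rightarrow> ('a \<times> 'a \<Rightarrow> real) \<Rightarrow> bool" where
  "symmetric_kernel \<Omega> A \<longleftrightarrow> (AE (x, x') in lebesgue_on (\<Omega> \<times> \<Omega>). A (x, x') = A (x', x))"

definition strictly_positive_definite ::
    "'a::euclidean_space set \<Rightarrow> ('a \<times> 'a \<Rightarrow> real) \<Rightarrow> bool" where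
  "strictly_positive_definite \<Omega> A \<longleftrightarrow>
     (\<forall>\<phi>\<in>test_functions \<Omega>. \<phi> \<noteq> (\<lambda>x. 0) \<longrightarrow>
        (LINT x:\<Omega>|lebesgue. LINT x':\<Omega>|lebesgue. A (x, x') * \<phi> x * \<phi> x') > 0)"

text \<open>The inner product of the type \<open>real^'n^'n\<close> is the Frobenius product.\<close>

lemma inner_matrix_eq_frobenius:
  fixes \<alpha> \<beta> :: "real^'n^'n"
  shows "\<alpha> \<bullet> \<beta> = (\<Sum>k\<in>UNIV. \<Sum>m\<in>UNIV. \<alpha> $ k $ m * \<beta> $ k $ m)"
  by (simp add: inner_vec_def)

definition grad :: "(real^'n \<Rightarrow> real^'n) \<Rightarrow> real^'n \<Rightarrow> real^'n^'n" where
  "grad u x = matrix (frechet_derivative u (at x))"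

definition strain :: "(real^'n \<Rightarrow> real^'n) \<Rightarrow> real^'n \<Rightarrow> real^'n^'n" where
  "strain u x = (1/2) *\<^sub>R (grad u x + transpose (grad u x))"

definition grad_form ::
    "(real^'n) set \<Rightarrow> ((real^'n) \<times> (real^'n) \<Rightarrow> real) \<Rightarrow>
     (real^'n \<Rightarrow> real^'n) \<Rightarrow> (real^'n \<Rightarrow> real^'n) \<Rightarrow> real" where
  "grad_form \<Omega> A u v =
     (LINT x:\<Omega>|lebesgue. LINT x':\<Omega>|lebesgue. A (x, x') * (grad u x \<bullet> grad v x'))"

definition strain_form ::
    "(real^'n) set \<Rightarrow> ((real^'n) \<times> (real^'n) \<Rightarrow> real) \<Rightarrow>
     (real^'n \<Rightarrow> real^'n) \<Rightarrow> (real^'n \<Rightarrow> real^'n) \<Rightarrow> real" where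
  "strain_form \<Omega> A u v =
     (LINT x:\<Omega>|lebesgue. LINT x':\<Omega>|lebesgue. A (x, x') * (strain u x \<bullet> strain v x'))"

definition A_norm ::
    "(real^'n) set \<Rightarrow> ((real^'n) \<times> (real^'n) \<Rightarrow> real) \<Rightarrow> (real^'n \<Rightarrow> real^'n) \<Rightarrow> real" where
  "A_norm \<Omega> A u = sqrt (grad_form \<Omega> A u u)"

definition A_Cauchy ::
    "(real^'n) set \<Rightarrow> ((real^'n) \<times> (real^'n) \<Rightarrow> real) \<Rightarrow> (nat \<Rightarrow> real^'n \<Rightarrow> real^'n) \<Rightarrow> bool" where
  "A_Cauchy \<Omega> A s \<longleftrightarrow> (\<forall>k. s k \<in> test_functions \<Omega>) \<and>
     (\<forall>e>0. \<exists>N. \<forall>i\<ge>N. \<forall>j\<ge>N. A_norm \<Omega> A (\<lambda>x. s i x - s j x) < e)"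

text \<open>The completion of the test fields: Cauchy sequences modulo null sequences.\<close>

definition V_space ::
    "(real^'n) set \<Rightarrow> ((real^'n) \<times> (real^'n) \<Rightarrow> real) \<Rightarrow> (nat \<Rightarrow> real^'n \<Rightarrow> real^'n) set set" where
  "V_space \<Omega> A =
     {s. A_Cauchy \<Omega> A s} //
     {(s, t). A_Cauchy \<Omega> A s \<and> A_Cauchy \<Omega> A t \<and>
        (\<lambda>k. A_norm \<Omega> A (\<lambda>x. s k x - t k x)) \<longlonglongrightarrow> 0}"

text \<open>Extension by continuity to the completion of a form \<open>b\<close> on test fields: the common limit of
  \<open>b\<close> along all Cauchy sequences representing the two arguments. The inner product of the
  completion is the extension of \<^const>\<open>grad_form\<close>.\<close>

definition extend_form ::
    "((real^'n \<Rightarrow> real^'n) \<Rightarrow> (real^'n \<Rightarrow> real^'n) \<Rightarrow> real) \<Rightarrow>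
     (nat \<Rightarrow> real^'n \<Rightarrow> real^'n) set \<Rightarrow> (nat \<Rightarrow> real^'n \<Rightarrow> real^'n) set \<Rightarrow> real" where
  "extend_form b U V = (THE l. \<forall>s\<in>U. \<forall>t\<in>V. (\<lambda>k. b (s k) (t k)) \<longlonglongrightarrow> l)"

end

theory Submission
  imports Defs
begin

text \<open>Let \<open>Q(F, G)\<close> be the double integral of \<open>A(x, x') F(x) \<bullet> G(x')\<close> for test functions with values in a
  Euclidean space. Positive definiteness of \<open>A\<close>, applied to each component, makes \<open>Q\<close> positive
  semidefinite. Expanding the strain gives, for a test field \<open>u\<close>,
  \<open>2 Q(\<epsilon>\<^sub>u, \<epsilon>\<^sub>u) = Q(\<nabla>u, \<nabla>u) + Q(\<nabla>u, (\<nabla>u)\<^sup>T)\<close>, so the inequality says that the last term is nonnegative.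
  It is, because it equals \<open>Q(div u, div u)\<close>.

  The equality is where the assumption on the derivatives of \<open>A\<close> enters. Testing the weak derivatives of
  \<open>A\<close> with \<open>\<phi>(x) \<psi>(x')\<close> yields \<open>Q(\<partial>\<^sub>k\<phi>, \<psi>) = \<gamma> Q(\<phi>, \<partial>\<^sub>k\<psi>)\<close>
  (\<open>form_directional_derivative_swap\<close>). Therefore
  \<open>Q(\<partial>\<^sub>ju\<^sub>i, \<partial>\<^sub>iu\<^sub>j) = \<gamma> Q(u\<^sub>i, \<partial>\<^sub>j\<partial>\<^sub>iu\<^sub>j) = \<gamma> Q(u\<^sub>i, \<partial>\<^sub>i\<partial>\<^sub>ju\<^sub>j) = Q(\<partial>\<^sub>iu\<^sub>i, \<partial>\<^sub>ju\<^sub>j)\<close>,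
  and summing over \<open>i\<close> and \<open>j\<close> gives the claim (\<open>grad_transpose_form_eq_divergence_form\<close>). The middle
  step is the symmetry of second derivatives.

  The inequality for test fields passes to the completion by continuity. Both forms extend because
  \<open>Q\<close> satisfies the Cauchy--Schwarz inequality and \<open>Q(\<epsilon>\<^sub>u, \<epsilon>\<^sub>u) \<le> Q(\<nabla>u, \<nabla>u)\<close>
  (\<open>extend_form_limit\<close>): along every pair of representing sequences they have a common limit.\<close>

section \<open>Calculus of smooth functions\<close>

lemma C_diff_SucI:
  assumes "\<And>x. (f has_derivative f' x) (at x)" and "\<And>v. C_diff m (\<lambda>x. f' x v)"
  shows "C_diff (Suc m) f"
proof -
  have "frechet_derivative f (at x) = f' x" for x
    using frechet_derivative_at[OF assms(1)] by simp
  then show ?thesis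
    using assms by (auto simp: differentiable_def)
qed

lemma C_diff_has_derivative:
  assumes "C_diff (Suc m) f"
  shows "(f has_derivative frechet_derivative f (at x)) (at x)"
  using assms by (simp add: frechet_derivative_works[symmetric])

lemma C_diff_SucD: "C_diff (Suc m) f \<Longrightarrow> C_diff m f"
proof (induction m arbitrary: f)
  case 0
  then show ?case
    by (auto simp: continuous_on_eq_continuous_at intro: differentiable_imp_continuous_within)
next
  case (Suc m)
  show ?case
    using Suc.prems by (intro C_diff_SucI[OF C_diff_has_derivative[OF Suc.prems]] Suc.IH) simp
qed

lemma C_diff_continuous_on: "C_diff m f \<Longrightarrow> continuous_on UNIV f"
  by (induction m) (simp, metis C_diff_SucD)

lemma C_diff_const: "C_diff m (\<lambda>x. c)"
proof (induction m arbitrary: c)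
  case 0 then show ?case by simp
next
  case (Suc m)
  show ?case by (rule C_diff_SucI[where f' = "\<lambda>x v. 0"]) (auto intro: Suc)
qed

lemma C_diff_add:
  "C_diff m f \<Longrightarrow> C_diff m g \<Longrightarrow> C_diff m (\<lambda>x. f x + g x)"
proof (induction m arbitrary: f g)
  case 0 then show ?case by (simp add: continuous_on_add)
next
  case (Suc m)
  show ?case
    by (rule C_diff_SucI[OF has_derivative_add[OF Suc.prems[THEN C_diff_has_derivative]]])
       (use Suc in simp)
qed

lemma C_diff_linear_image:
  assumes "bounded_linear L"
  shows "C_diff m f \<Longrightarrow> C_diff m (\<lambda>x. L (f x))"
proof (induction m arbitrary: f)
  case 0 then show ?case
    using bounded_linear.continuous_on[OF assms] by simp
next
  case (Suc m)
  show ?case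
    by (rule C_diff_SucI[OF bounded_linear.has_derivative[OF assms C_diff_has_derivative[OF Suc.prems]]])
       (use Suc in simp)
qed

lemma C_diff_compose_linear:
  assumes "bounded_linear L"
  shows "C_diff m f \<Longrightarrow> C_diff m (\<lambda>x. f (L x))"
proof (induction m arbitrary: f)
  case 0
  have "continuous_on UNIV L"
    using assms by (simp add: linear_continuous_on)
  with 0 show ?case
    using continuous_on_compose2 by fastforce
next
  case (Suc m)
  have L: "(L has_derivative L) (at x)" for x
    using assms by (rule bounded_linear_imp_has_derivative)
  show ?case
    by (rule C_diff_SucI[OF has_derivative_compose[OF L C_diff_has_derivative[OF Suc.prems]]], rule Suc.IH)
       (use Suc.prems in simp)
qed

lemma C_diff_bilinear:
  assumes "bounded_bilinear p"
  shows "C_diff m f \<Longrightarrow> C_diff m g \<Longrightarrow> C_diff m (\<lambda>x. p (f x) (g x))"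
proof (induction m arbitrary: f g)
  case 0 then show ?case
    using bounded_bilinear.continuous_on[OF assms] by simp
next
  case (Suc m)
  have D: "C_diff m (\<lambda>x. frechet_derivative f (at x) v)"
    "C_diff m (\<lambda>x. frechet_derivative g (at x) v)" for v
    using Suc.prems by simp_all
  show ?case
    by (rule C_diff_SucI[OF bounded_bilinear.FDERIV[OF assms Suc.prems[THEN C_diff_has_derivative]]])
       (intro C_diff_add Suc.IH D Suc.prems[THEN C_diff_SucD])
qed

lemma has_real_derivative_along_line:
  fixes f :: "'a::euclidean_space \<Rightarrow> real"
  assumes "C_diff (Suc m) f"
  shows "((\<lambda>s. f (p + s *\<^sub>R v)) has_real_derivative
           frechet_derivative f (at (p + s *\<^sub>R v)) v) (at s)"
proof -
  let ?D = "frechet_derivative f (at (p + s *\<^sub>R v))"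
  have l: "((\<lambda>s. p + s *\<^sub>R v) has_derivative (\<lambda>h. h *\<^sub>R v)) (at s)"
    by (auto intro!: derivative_eq_intros)
  have D: "(f has_derivative ?D) (at (p + s *\<^sub>R v))"
    by (rule C_diff_has_derivative[OF assms])
  have "linear ?D"
    using D by (rule has_derivative_linear)
  then have "(\<lambda>h. ?D (h *\<^sub>R v)) = (*) (?D v)"
    by (auto simp: linear_cmul)
  then show ?thesis
    using has_derivative_compose[OF l D] by (simp add: has_field_derivative_def)
qed

text \<open>The second difference is symmetric in \<open>v\<close> and \<open>w\<close>, whereas the mixed derivative on the right is
  not visibly so. Comparing the two orders as \<open>t\<close> tends to zero gives the symmetry of second
  derivatives. The mean value theorem is applied first along \<open>v\<close>, to the difference of
  \<open>f\<close> between two parallel segments, and then along \<open>w\<close>, to \<open>\<partial>\<^sub>v f\<close>.\<close>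

lemma second_difference_mean_value:
  fixes f :: "'a::euclidean_space \<Rightarrow> real"
  assumes f: "C_diff (Suc (Suc m)) f" and t: "t > 0"
  shows "\<exists>a b. 0 < a \<and> a < t \<and> 0 < b \<and> b < t \<and>
    f (x + t *\<^sub>R v + t *\<^sub>R w) - f (x + t *\<^sub>R v) - f (x + t *\<^sub>R w) + f x
      = t\<^sup>2 * frechet_derivative (\<lambda>y. frechet_derivative f (at y) v) (at (x + a *\<^sub>R v + b *\<^sub>R w)) w"
proof -
  let ?fv = "\<lambda>y. frechet_derivative f (at y) v"
  have fv: "C_diff (Suc m) ?fv" using f by simp
  define h where "h s = f ((x + t *\<^sub>R w) + s *\<^sub>R v) - f (x + s *\<^sub>R v)" for s
  have "(h has_real_derivative ?fv ((x + t *\<^sub>R w) + s *\<^sub>R v) - ?fv (x + s *\<^sub>R v)) (at s)" for s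
    unfolding h_def by (intro DERIV_diff has_real_derivative_along_line[OF f])
  then obtain a where a: "0 < a" "a < t"
      "h t - h 0 = t * (?fv ((x + t *\<^sub>R w) + a *\<^sub>R v) - ?fv (x + a *\<^sub>R v))"
    using MVT2[OF t, of h "\<lambda>s. ?fv ((x + t *\<^sub>R w) + s *\<^sub>R v) - ?fv (x + s *\<^sub>R v)"] by auto
  obtain b where b: "0 < b" "b < t"
    "?fv ((x + a *\<^sub>R v) + t *\<^sub>R w) - ?fv ((x + a *\<^sub>R v) + 0 *\<^sub>R w)
       = (t - 0) * frechet_derivative ?fv (at ((x + a *\<^sub>R v) + b *\<^sub>R w)) w"
    using MVT2[OF t has_real_derivative_along_line[OF fv, of "x + a *\<^sub>R v" w]] by blast
  show ?thesis
    using a b by (intro exI[of _ a] exI[of _ b]) (simp add: h_def algebra_simps power2_eq_square)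
qed

lemma mixed_second_derivatives_commute:
  fixes f :: "'a::euclidean_space \<Rightarrow> real"
  assumes f: "C_diff 2 f"
  shows "frechet_derivative (\<lambda>y. frechet_derivative f (at y) v) (at x) w =
         frechet_derivative (\<lambda>y. frechet_derivative f (at y) w) (at x) v"
proof -
  define D where "D v w y = frechet_derivative (\<lambda>y. frechet_derivative f (at y) v) (at y) w" for v w y
  define \<Delta> where "\<Delta> v w t = (f (x + t *\<^sub>R v + t *\<^sub>R w) - f (x + t *\<^sub>R v) - f (x + t *\<^sub>R w) + f x) / t\<^sup>2"
    for v w t
  have f': "C_diff (Suc (Suc 0)) f" using f by (simp add: numeral_2_eq_2)
  have lim: "(\<lambda>n. \<Delta> v w (inverse (real (Suc n)))) \<longlonglongrightarrow> D v w x" for v w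
  proof -
    have "\<exists>a b. 0 < a \<and> a < t \<and> 0 < b \<and> b < t \<and> \<Delta> v w t = D v w (x + a *\<^sub>R v + b *\<^sub>R w)"
      if "t > 0" for t
      using second_difference_mean_value[OF f' that, of x v w] that
      by (auto simp: \<Delta>_def D_def field_simps)
    then have "\<forall>n. \<exists>a b. 0 < a \<and> a < inverse (real (Suc n)) \<and> 0 < b \<and> b < inverse (real (Suc n)) \<and>
        \<Delta> v w (inverse (real (Suc n))) = D v w (x + a *\<^sub>R v + b *\<^sub>R w)"
      by simp
    then obtain a b where ab: "\<And>n. 0 < a n \<and> a n < inverse (real (Suc n)) \<and>
        0 < b n \<and> b n < inverse (real (Suc n)) \<and>
        \<Delta> v w (inverse (real (Suc n))) = D v w (x + a n *\<^sub>R v + b n *\<^sub>R w)"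
      by metis
    have "a \<longlonglongrightarrow> 0"
      by (rule tendsto_sandwich[OF _ _ tendsto_const LIMSEQ_inverse_real_of_nat])
         (use ab in \<open>auto intro!: always_eventually less_imp_le\<close>)
    moreover have "b \<longlonglongrightarrow> 0"
      by (rule tendsto_sandwich[OF _ _ tendsto_const LIMSEQ_inverse_real_of_nat])
         (use ab in \<open>auto intro!: always_eventually less_imp_le\<close>)
    ultimately have "(\<lambda>n. x + a n *\<^sub>R v + b n *\<^sub>R w) \<longlonglongrightarrow> x + 0 *\<^sub>R v + 0 *\<^sub>R w"
      by (intro tendsto_intros)
    moreover have "isCont (D v w) x"
      using f' by (simp add: D_def[abs_def] continuous_on_eq_continuous_at)
    ultimately have "(\<lambda>n. D v w (x + a n *\<^sub>R v + b n *\<^sub>R w)) \<longlonglongrightarrow> D v w x"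
      by (auto intro: isCont_tendsto_compose)
    then show ?thesis
      using ab by simp
  qed
  (* Both mixed derivatives are limits of one and the same difference quotient. *)
  have "\<Delta> v w = \<Delta> w v"
    by (auto simp: \<Delta>_def fun_eq_iff algebra_simps)
  then have "D v w x = D w v x"
    using LIMSEQ_unique[OF lim[of v w]] lim[of w v] by simp
  then show ?thesis by (simp add: D_def)
qed

section \<open>Test functions\<close>

lemma test_functionsI:
  assumes "\<And>m. C_diff m f" "{x. f x \<noteq> 0} \<subseteq> K" "compact K" "K \<subseteq> U"
  shows "f \<in> test_functions U"
proof -
  have "closure {x. f x \<noteq> 0} \<subseteq> K"
    using assms(2,3) by (simp add: closure_minimal compact_imp_closed)
  moreover from this have "compact (closure {x. f x \<noteq> 0})"
    using compact_Int_closed[OF assms(3) closed_closure, of "{x. f x \<noteq> 0}"]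
    by (simp add: Int_absorb1)
  ultimately show ?thesis
    using assms by (auto simp: test_functions_def)
qed

lemma test_functions_C_diff: "f \<in> test_functions U \<Longrightarrow> C_diff m f"
  by (simp add: test_functions_def)

lemma test_functions_support:
  assumes "f \<in> test_functions U"
  obtains K where "compact K" "K \<subseteq> U" "closed K" "{x. f x \<noteq> 0} \<subseteq> K"
proof
  show "compact (closure {x. f x \<noteq> 0})" "closure {x. f x \<noteq> 0} \<subseteq> U"
    "{x. f x \<noteq> 0} \<subseteq> closure {x. f x \<noteq> 0}"
    using assms closure_subset[of "{x. f x \<noteq> 0}"] by (simp_all add: test_functions_def)
qed simp

lemma test_functions_zero: "(\<lambda>x. 0) \<in> test_functions U"
  by (rule test_functionsI[where K = "{}"]) (auto intro: C_diff_const)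

lemma test_functions_add:
  assumes f: "f \<in> test_functions U" and g: "g \<in> test_functions U"
  shows "(\<lambda>x. f x + g x) \<in> test_functions U"
proof -
  obtain K L where "compact K" "K \<subseteq> U" "{x. f x \<noteq> 0} \<subseteq> K" "compact L" "L \<subseteq> U" "{x. g x \<noteq> 0} \<subseteq> L"
    using test_functions_support[OF f] test_functions_support[OF g] by metis
  then show ?thesis
    by (intro test_functionsI[where K = "K \<union> L"] C_diff_add test_functions_C_diff[OF f] test_functions_C_diff[OF g])
       (auto simp: subset_iff, metis add.right_neutral)
qed

lemma test_functions_linear_image:
  assumes L: "bounded_linear L" and f: "f \<in> test_functions U"
  shows "(\<lambda>x. L (f x)) \<in> test_functions U"
proof -
  obtain K where "compact K" "K \<subseteq> U" "{x. f x \<noteq> 0} \<subseteq> K"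
    using test_functions_support[OF f] by metis
  then show ?thesis
    using linear_0[OF bounded_linear.linear[OF L]]
    by (intro test_functionsI[where K = K] C_diff_linear_image[OF L] test_functions_C_diff[OF f]) auto
qed

lemma test_functions_scaleR:
  "F \<in> test_functions U \<Longrightarrow> (\<lambda>x. c *\<^sub>R F x) \<in> test_functions U"
  by (rule test_functions_linear_image[OF bounded_linear_scaleR_right])

lemma test_functions_diff:
  assumes "f \<in> test_functions U" "g \<in> test_functions U"
  shows "(\<lambda>x. f x - g x) \<in> test_functions U"
  using test_functions_add[OF assms(1)
      test_functions_linear_image[OF bounded_linear_minus[OF bounded_linear_ident] assms(2)]]
  by simp

lemma test_functions_sum:
  assumes "\<And>i. i \<in> I \<Longrightarrow> f i \<in> test_functions U"
  shows "(\<lambda>x. \<Sum>i\<in>I. f i x) \<in> test_functions U"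
  using assms
  by (induction I rule: infinite_finite_induct) (auto simp: test_functions_zero test_functions_add)

lemma test_functions_directional_derivative:
  assumes f: "f \<in> test_functions U"
  shows "(\<lambda>x. frechet_derivative f (at x) v) \<in> test_functions U"
proof -
  obtain K where K: "compact K" "K \<subseteq> U" "closed K" "{x. f x \<noteq> 0} \<subseteq> K"
    using test_functions_support[OF f] by metis
  have "frechet_derivative f (at x) v = 0" if "x \<notin> K" for x
  proof -
    have "(f has_derivative (\<lambda>v. 0)) (at x)"
      by (rule has_derivative_transform_within_open[where f = "\<lambda>x. 0" and s = "- K"])
         (use K that in auto)
    then show ?thesis
      using frechet_derivative_at by metis
  qed
  then show ?thesis
    using K test_functions_C_diff[OF f, of "Suc m" for m]
    by (intro test_functionsI[where K = K]) auto
qed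

text \<open>The weak derivatives of the kernel are tested with these functions: this is how a statement about
  test functions on \<open>U \<times> U\<close> yields one about pairs of test functions on \<open>U\<close>.\<close>

lemma test_functions_tensor:
  fixes F G :: "'a::euclidean_space \<Rightarrow> 'b::euclidean_space"
  assumes F: "F \<in> test_functions U" and G: "G \<in> test_functions U"
  shows "(\<lambda>z. F (fst z) \<bullet> G (snd z)) \<in> test_functions (U \<times> U)"
proof -
  obtain K L where "compact K" "K \<subseteq> U" "{x. F x \<noteq> 0} \<subseteq> K" "compact L" "L \<subseteq> U" "{x. G x \<noteq> 0} \<subseteq> L"
    using test_functions_support[OF F] test_functions_support[OF G] by metis
  then have KL: "compact (K \<times> L)" "K \<times> L \<subseteq> U \<times> U"
    "{z. F (fst z) \<bullet> G (snd z) \<noteq> 0} \<subseteq> K \<times> L"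
    by (simp_all add: compact_Times Sigma_mono) (auto simp: subset_iff, (metis inner_zero_left inner_zero_right)+)
  have "C_diff m (\<lambda>z::'a\<times>'a. F (fst z) \<bullet> G (snd z))" for m
    by (intro C_diff_bilinear[OF bounded_bilinear_inner]
         C_diff_compose_linear[OF bounded_linear_fst test_functions_C_diff[OF F]]
         C_diff_compose_linear[OF bounded_linear_snd test_functions_C_diff[OF G]])
  then show ?thesis
    by (rule test_functionsI[OF _ KL(3,1,2)])
qed

lemma frechet_derivative_tensor:
  fixes F G :: "'a::euclidean_space \<Rightarrow> 'b::euclidean_space"
  assumes F: "F \<in> test_functions U" and G: "G \<in> test_functions U"
  shows "frechet_derivative (\<lambda>z. F (fst z) \<bullet> G (snd z)) (at z) (v, w) =
    F (fst z) \<bullet> frechet_derivative G (at (snd z)) w + frechet_derivative F (at (fst z)) v \<bullet> G (snd z)"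
proof -
  have dF: "((\<lambda>z. F (fst z)) has_derivative (\<lambda>d. frechet_derivative F (at (fst z)) (fst d))) (at z)"
    by (rule has_derivative_compose[OF has_derivative_fst[OF has_derivative_ident]
          C_diff_has_derivative[OF test_functions_C_diff[OF F, of "Suc 0"]]])
  have dG: "((\<lambda>z. G (snd z)) has_derivative (\<lambda>d. frechet_derivative G (at (snd z)) (snd d))) (at z)"
    by (rule has_derivative_compose[OF has_derivative_snd[OF has_derivative_ident]
          C_diff_has_derivative[OF test_functions_C_diff[OF G, of "Suc 0"]]])
  show ?thesis
    by (simp flip: frechet_derivative_at[OF has_derivative_inner[OF dF dG]])
qed

section \<open>Iterated Lebesgue integrals\<close>

lemma integral_lebesgue_eq_lborel:
  fixes f :: "'a::euclidean_space \<Rightarrow> real"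
  assumes g: "g \<in> borel_measurable lborel" and ae: "AE x in lborel. f x = g x"
  shows "(LINT x|lebesgue. f x) = (LINT x|lborel. g x)"
proof -
  have g': "g \<in> borel_measurable lebesgue"
    using g by (rule measurable_completion)
  have ae': "AE x in lebesgue. g x = f x"
    using ae by (intro AE_completion) (auto elim: eventually_mono)
  have "(LINT x|lebesgue. g x) = (LINT x|lebesgue. f x)"
    by (rule integral_cong_AE[OF g' borel_measurable_AE[OF g' ae'] ae'])
  then show ?thesis
    using integral_completion[OF g] by simp
qed

text \<open>Lebesgue measure on the product space is the completion of the product of the Borel--Lebesgue
  measures, not the product of the Lebesgue measures, and a section of a Lebesgue measurable function
  can be non-measurable for a null set of parameters. Both issues disappear after replacing \<open>f\<close> by
  a Borel function that agrees with it almost everywhere: almost every section of the exceptional null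
  set is null, so the iterated integrals do not change either.\<close>

lemma Fubini_lebesgue:
  fixes f :: "'a::euclidean_space \<times> 'b::euclidean_space \<Rightarrow> real"
  assumes f: "integrable lebesgue f"
  shows "(LINT x|lebesgue. LINT y|lebesgue. f (x, y)) = (LINT z|lebesgue. f z)"
    and "(LINT y|lebesgue. LINT x|lebesgue. f (x, y)) = (LINT z|lebesgue. f z)"
proof -
  obtain g where g: "g \<in> borel_measurable lborel" and fg: "AE z in lborel. f z = g z"
    using completion_ex_borel_measurable_real[OF borel_measurable_integrable[OF f]] by blast
  have "integrable lebesgue g"
    using f fg by (rule integrable_cong_AE_imp[OF _ measurable_completion[OF g] AE_completion])
  then have g_int: "integrable (lborel \<Otimes>\<^sub>M lborel) g"
    using g by (simp add: integrable_completion lborel_prod)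
  have int_eq: "(LINT z|lebesgue. f z) = integral\<^sup>L (lborel \<Otimes>\<^sub>M lborel) g"
    unfolding lborel_prod by (rule integral_lebesgue_eq_lborel[OF g fg])
  have meas [measurable]: "g \<in> borel_measurable (lborel \<Otimes>\<^sub>M lborel)"
    using g by (simp add: lborel_prod)
  have m1: "(\<lambda>y. g (x, y)) \<in> borel_measurable lborel" for x by measurable
  have m2: "(\<lambda>x. g (x, y)) \<in> borel_measurable lborel" for y by measurable
  obtain N where N: "N \<in> null_sets (lborel \<Otimes>\<^sub>M lborel)" and Nfg: "\<And>z. z \<notin> N \<Longrightarrow> f z = g z"
    using fg unfolding eventually_ae_filter lborel_prod by auto
  have ae1: "AE x in lborel. AE y in lborel. (x, y) \<notin> N"
    using lborel_pair.AE_pair[OF AE_not_in[OF N]] .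
  have "(AE x in lborel. AE y in lborel. (x, y) \<notin> N) \<longleftrightarrow> (AE y in lborel. AE x in lborel. (x, y) \<notin> N)"
    by (rule lborel_pair.AE_commute) (use null_setsD2[OF N] in measurable)
  with ae1 have ae2: "AE y in lborel. AE x in lborel. (x, y) \<notin> N"
    by simp
  have "(LINT x|lebesgue. LINT y|lebesgue. f (x, y)) = (LINT x|lborel. LINT y|lborel. g (x, y))"
  proof (rule integral_lebesgue_eq_lborel)
    show "AE x in lborel. (LINT y|lebesgue. f (x, y)) = (LINT y|lborel. g (x, y))"
      using ae1
      by eventually_elim (rule integral_lebesgue_eq_lborel[OF m1], auto elim!: eventually_mono intro: Nfg)
  qed measurable
  then show "(LINT x|lebesgue. LINT y|lebesgue. f (x, y)) = (LINT z|lebesgue. f z)"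
    by (simp add: int_eq lborel_pair.integral_fst'[OF g_int])
  have "(LINT y|lebesgue. LINT x|lebesgue. f (x, y)) = (LINT y|lborel. LINT x|lborel. g (x, y))"
  proof (rule integral_lebesgue_eq_lborel)
    show "AE y in lborel. (LINT x|lebesgue. f (x, y)) = (LINT x|lborel. g (x, y))"
      using ae2
      by eventually_elim (rule integral_lebesgue_eq_lborel[OF m2], auto elim!: eventually_mono intro: Nfg)
  qed measurable
  then show "(LINT y|lebesgue. LINT x|lebesgue. f (x, y)) = (LINT z|lebesgue. f z)"
    using lborel_pair.integral_snd[of "\<lambda>x y. g (x, y)"] g_int by (simp add: int_eq)
qed

text \<open>The test function is bounded and vanishes off a compact subset of \<open>U\<close>, where \<open>f\<close> is integrable.\<close>

lemma integrable_locally_integrable_times_test: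
  fixes f :: "'a::euclidean_space \<Rightarrow> real"
  assumes f: "locally_integrable_on f U" and \<phi>: "\<phi> \<in> test_functions U"
  shows "integrable lebesgue (\<lambda>z. indicator U z * (f z * \<phi> z))"
proof -
  obtain K where K: "compact K" "K \<subseteq> U" "{x. \<phi> x \<noteq> 0} \<subseteq> K"
    using test_functions_support[OF \<phi>] by metis
  have cont: "continuous_on UNIV \<phi>"
    by (rule C_diff_continuous_on[OF test_functions_C_diff[OF \<phi>, of 0]])
  have "bounded (\<phi> ` K)"
    using K(1) cont by (meson compact_continuous_image compact_imp_bounded continuous_on_subset subset_UNIV)
  then obtain B where "\<And>z. z \<in> K \<Longrightarrow> \<bar>\<phi> z\<bar> \<le> B" and "B > 0"
    unfolding bounded_pos by auto
  then have B: "\<bar>\<phi> z\<bar> \<le> \<bar>B\<bar>" for z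
    using K(3) by (cases "z \<in> K") (force, force)
  have int: "integrable lebesgue (\<lambda>z. indicator K z * f z)"
    using f K(1,2) by (simp add: locally_integrable_on_def set_integrable_def)
  have "\<phi> \<in> borel_measurable borel"
    using cont by (rule borel_measurable_continuous_onI)
  then have \<phi>m: "\<phi> \<in> borel_measurable lebesgue"
    by (simp add: measurable_completion)
  have "integrable lebesgue (\<lambda>z. (indicator K z * f z) * \<phi> z)"
  proof (rule Bochner_Integration.integrable_bound)
    show "integrable lebesgue (\<lambda>z. (indicator K z * f z) * B)"
      using int by simp
    show "(\<lambda>z. (indicator K z * f z) * \<phi> z) \<in> borel_measurable lebesgue"
      by (rule borel_measurable_times[OF borel_measurable_integrable[OF int] \<phi>m])
    show "AE z in lebesgue. norm (indicator K z * f z * \<phi> z) \<le> norm (indicator K z * f z * B)"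
      using B by (auto simp: abs_mult intro!: AE_I2 mult_left_mono)
  qed
  moreover have "(\<lambda>z. (indicator K z * f z) * \<phi> z) = (\<lambda>z. indicator U z * (f z * \<phi> z))"
    using K(2,3) by (fastforce simp: fun_eq_iff indicator_def)
  ultimately show ?thesis by simp
qed

section \<open>The semidefinite form of a positive kernel\<close>

lemma nonneg_quadratic_discriminant:
  fixes a b c :: real
  assumes "c \<ge> 0" and nonneg: "\<And>t. a + 2 * t * b + t\<^sup>2 * c \<ge> 0"
  shows "b\<^sup>2 \<le> a * c"
proof (cases "c = 0")
  case True
  have "b = 0"
  proof (rule ccontr)
    assume "b \<noteq> 0"
    then show False
      (* At this point the affine function a + 2 * t * b takes the value -1. *)
      using nonneg[of "- (a + 1) / (2 * b)"] True by (simp add: field_simps)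
  qed
  then show ?thesis using True by simp
next
  case False
  with assms(1) have "c > 0" by simp
  then show ?thesis
    (* The minimum of the quadratic. *)
    using nonneg[of "- b / c"] by (simp add: field_simps power2_eq_square)
qed

text \<open>Taking \<open>F\<close> and \<open>G\<close> with values in an inner product space treats the forms of gradients and
  of strains (matrix-valued) and that of divergences (scalar) at once.\<close>

definition kernel_form ::
    "'a::euclidean_space set \<Rightarrow> ('a \<times> 'a \<Rightarrow> real) \<Rightarrow> ('a \<Rightarrow> 'b::real_inner) \<Rightarrow> ('a \<Rightarrow> 'b) \<Rightarrow> real" where
  "kernel_form \<Omega> A F G =
     (LINT x:\<Omega>|lebesgue. LINT x':\<Omega>|lebesgue. A (x, x') * (F x \<bullet> G x'))"

locale positive_kernel =
  fixes \<Omega> :: "'a::euclidean_space set" and A :: "'a \<times> 'a \<Rightarrow> real"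
  assumes open_domain: "open \<Omega>"
    and locally_integrable: "locally_integrable_on A (\<Omega> \<times> \<Omega>)"
    and symmetric: "symmetric_kernel \<Omega> A"
    and positive: "strictly_positive_definite \<Omega> A"
begin

abbreviation form :: "('a \<Rightarrow> 'b::euclidean_space) \<Rightarrow> ('a \<Rightarrow> 'b) \<Rightarrow> real" where
  "form \<equiv> kernel_form \<Omega> A"

abbreviation integrand :: "('a \<Rightarrow> 'b::euclidean_space) \<Rightarrow> ('a \<Rightarrow> 'b) \<Rightarrow> 'a \<times> 'a \<Rightarrow> real" where
  "integrand F G \<equiv> \<lambda>z. indicator (\<Omega> \<times> \<Omega>) z * (A z * (F (fst z) \<bullet> G (snd z)))"

lemma integrable_integrand:
  assumes "F \<in> test_functions \<Omega>" "G \<in> test_functions \<Omega>"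
  shows "integrable lebesgue (integrand F G)"
  by (rule integrable_locally_integrable_times_test[OF locally_integrable test_functions_tensor[OF assms]])

lemma form_eq_integral:
  assumes "F \<in> test_functions \<Omega>" "G \<in> test_functions \<Omega>"
  shows "form F G = (LINT z|lebesgue. integrand F G z)"
proof -
  have "form F G = (LINT x|lebesgue. LINT x'|lebesgue. integrand F G (x, x'))"
    unfolding kernel_form_def set_lebesgue_integral_def
    by (simp flip: integral_mult_right_zero add: indicator_times algebra_simps)
  then show ?thesis
    by (simp only: Fubini_lebesgue(1)[OF integrable_integrand[OF assms]])
qed

text \<open>Exchanging the names of the variables turns \<open>form G F\<close> into the integral of
  \<open>A (x', x) * (F x \<bullet> G x')\<close>, in the other order of integration. Its integrand agrees almost everywhere
  with that of \<open>form F G\<close>.\<close>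

lemma form_sym:
  assumes F: "F \<in> test_functions \<Omega>" and G: "G \<in> test_functions \<Omega>"
  shows "form F G = form G F"
proof -
  have m: "\<Omega> \<times> \<Omega> \<in> sets lebesgue"
    using open_domain by (simp add: open_Times)
  define h where "h z = indicator (\<Omega> \<times> \<Omega>) z * (A (snd z, fst z) * (F (fst z) \<bullet> G (snd z)))" for z
  have "AE z in lebesgue. z \<in> \<Omega> \<times> \<Omega> \<longrightarrow> A (fst z, snd z) = A (snd z, fst z)"
    using symmetric m unfolding symmetric_kernel_def
    by (subst (asm) AE_restrict_space_iff) (auto simp: case_prod_beta)
  then have ae: "AE z in lebesgue. integrand F G z = h z"
    by eventually_elim (auto simp: h_def indicator_def)
  have int: "integrable lebesgue (integrand F G)"
    by (rule integrable_integrand[OF F G])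
  have hm: "h \<in> borel_measurable lebesgue"
    by (rule borel_measurable_AE[OF borel_measurable_integrable[OF int] ae])
  have h: "integrable lebesgue h"
    by (rule integrable_cong_AE_imp[OF int hm ae])
  have "form F G = (LINT z|lebesgue. h z)"
    unfolding form_eq_integral[OF F G]
    by (rule integral_cong_AE[OF borel_measurable_integrable[OF int] hm ae])
  also have "\<dots> = (LINT y|lebesgue. LINT x|lebesgue. h (x, y))"
    by (rule Fubini_lebesgue(2)[OF h, symmetric])
  also have "\<dots> = form G F"
    unfolding kernel_form_def set_lebesgue_integral_def h_def
    by (simp flip: integral_mult_right_zero add: indicator_times algebra_simps inner_commute)
  finally show ?thesis .
qed

lemma form_cong:
  assumes "\<And>x y. F x \<bullet> G y = F' x \<bullet> G' y"
  shows "kernel_form \<Omega> A F G = kernel_form \<Omega> A F' G'"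
  using assms by (simp add: kernel_form_def)

lemma form_eq_sum:
  fixes F G :: "'a \<Rightarrow> 'b::euclidean_space" and f g :: "'i \<Rightarrow> 'a \<Rightarrow> real"
  assumes F: "F \<in> test_functions \<Omega>" and G: "G \<in> test_functions \<Omega>"
    and f: "\<And>i. i \<in> I \<Longrightarrow> f i \<in> test_functions \<Omega>" and g: "\<And>i. i \<in> I \<Longrightarrow> g i \<in> test_functions \<Omega>"
    and eq: "\<And>x y. F x \<bullet> G y = (\<Sum>i\<in>I. f i x * g i y)"
  shows "form F G = (\<Sum>i\<in>I. form (f i) (g i))"
proof -
  have "integrand F G = (\<lambda>z. \<Sum>i\<in>I. integrand (f i) (g i) z)"
    by (simp add: eq sum_distrib_left)
  then have "form F G = (\<Sum>i\<in>I. LINT z|lebesgue. integrand (f i) (g i) z)"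
    using Bochner_Integration.integral_sum[of I lebesgue "\<lambda>i. integrand (f i) (g i)"]
      integrable_integrand[OF f g]
    by (simp add: form_eq_integral[OF F G])
  also have "\<dots> = (\<Sum>i\<in>I. form (f i) (g i))"
    by (rule sum.cong) (simp_all only: form_eq_integral[OF f g])
  finally show ?thesis .
qed

lemma form_add_left:
  assumes F: "F \<in> test_functions \<Omega>" and F': "F' \<in> test_functions \<Omega>" and G: "G \<in> test_functions \<Omega>"
  shows "form (\<lambda>x. F x + F' x) G = form F G + form F' G"
  using Bochner_Integration.integral_add[OF integrable_integrand[OF F G] integrable_integrand[OF F' G]]
  by (simp add: form_eq_integral assms test_functions_add algebra_simps)

lemma form_scaleR_left:
  assumes F: "F \<in> test_functions \<Omega>" and G: "G \<in> test_functions \<Omega>"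
  shows "form (\<lambda>x. c *\<^sub>R F x) G = c * form F G"
  unfolding form_eq_integral[OF F G] form_eq_integral[OF test_functions_scaleR[OF F] G]
  by (simp flip: integral_mult_right_zero add: algebra_simps)

lemma form_add_right:
  assumes F: "F \<in> test_functions \<Omega>" and G: "G \<in> test_functions \<Omega>" and G': "G' \<in> test_functions \<Omega>"
  shows "form F (\<lambda>x. G x + G' x) = form F G + form F G'"
  using form_add_left[OF G G' F] by (simp add: form_sym[OF F] G G' test_functions_add)

lemma form_scaleR_right:
  assumes F: "F \<in> test_functions \<Omega>" and G: "G \<in> test_functions \<Omega>"
  shows "form F (\<lambda>x. c *\<^sub>R G x) = c * form F G"
  using form_scaleR_left[OF G F] by (simp add: form_sym[OF F] G test_functions_scaleR)

lemma form_nonneg_scalar: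
  fixes \<phi> :: "'a \<Rightarrow> real"
  assumes "\<phi> \<in> test_functions \<Omega>"
  shows "form \<phi> \<phi> \<ge> 0"
proof (cases "\<phi> = (\<lambda>x. 0)")
  case True
  then show ?thesis by (simp add: kernel_form_def)
next
  case False
  then have "0 < (LINT x:\<Omega>|lebesgue. LINT x':\<Omega>|lebesgue. A (x, x') * \<phi> x * \<phi> x')"
    using positive assms by (simp add: strictly_positive_definite_def)
  then show ?thesis
    by (simp add: kernel_form_def mult.assoc)
qed

text \<open>Positivity is assumed for scalar test functions only; in an orthonormal basis the form is the sum of
  the scalar forms of the components.\<close>

lemma form_nonneg:
  fixes F :: "'a \<Rightarrow> 'b::euclidean_space"
  assumes F: "F \<in> test_functions \<Omega>"
  shows "form F F \<ge> 0"
proof -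
  have c: "(\<lambda>x. F x \<bullet> b) \<in> test_functions \<Omega>" for b
    by (rule test_functions_linear_image[OF bounded_linear_inner_left F])
  have "form F F = (\<Sum>b\<in>Basis. form (\<lambda>x. F x \<bullet> b) (\<lambda>x. F x \<bullet> b))"
    by (rule form_eq_sum[OF F F c c euclidean_inner])
  then show ?thesis
    by (simp add: sum_nonneg form_nonneg_scalar c)
qed

abbreviation seminorm :: "('a \<Rightarrow> 'b::euclidean_space) \<Rightarrow> real" where
  "seminorm F \<equiv> sqrt (form F F)"

lemma seminorm_Cauchy_Schwarz:
  assumes F: "F \<in> test_functions \<Omega>" and G: "G \<in> test_functions \<Omega>"
  shows "\<bar>form F G\<bar> \<le> seminorm F * seminorm G"
proof -
  have "form F F + 2 * t * form F G + t\<^sup>2 * form G G \<ge> 0" for t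
  proof -
    let ?H = "\<lambda>x. F x + t *\<^sub>R G x"
    have tG: "(\<lambda>x. t *\<^sub>R G x) \<in> test_functions \<Omega>"
      by (rule test_functions_scaleR[OF G])
    have H: "?H \<in> test_functions \<Omega>"
      by (rule test_functions_add[OF F tG])
    have "form ?H ?H = form F F + 2 * t * form F G + t\<^sup>2 * form G G"
      using form_sym[OF G F]
      by (simp add: form_add_left form_add_right form_scaleR_left form_scaleR_right F G tG H
          power2_eq_square algebra_simps)
    then show ?thesis using form_nonneg[OF H] by simp
  qed
  then have "(form F G)\<^sup>2 \<le> form F F * form G G"
    by (rule nonneg_quadratic_discriminant[OF form_nonneg[OF G]])
  then show ?thesis
    by (metis real_sqrt_abs real_sqrt_le_iff real_sqrt_mult)
qed

lemma seminorm_triangle: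
  assumes F: "F \<in> test_functions \<Omega>" and G: "G \<in> test_functions \<Omega>"
  shows "seminorm (\<lambda>x. F x + G x) \<le> seminorm F + seminorm G"
proof (rule real_le_lsqrt)
  have "form (\<lambda>x. F x + G x) (\<lambda>x. F x + G x) = form F F + 2 * form F G + form G G"
    using form_sym[OF G F]
    by (simp add: form_add_left form_add_right F G test_functions_add)
  also have "\<dots> \<le> (seminorm F + seminorm G)\<^sup>2"
    using seminorm_Cauchy_Schwarz[OF F G] form_nonneg[OF F] form_nonneg[OF G]
    by (simp add: power2_sum)
  finally show "form (\<lambda>x. F x + G x) (\<lambda>x. F x + G x) \<le> (seminorm F + seminorm G)\<^sup>2" .
qed (use form_nonneg[OF F] form_nonneg[OF G] in simp)

text \<open>By the triangle inequality the seminorms of a Cauchy sequence are themselves Cauchy.\<close>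

lemma form_convergent:
  assumes S: "\<And>k. S k \<in> test_functions \<Omega>"
    and Cauchy: "\<And>e. e > 0 \<Longrightarrow> \<exists>N. \<forall>i\<ge>N. \<forall>j\<ge>N. seminorm (\<lambda>x. S i x - S j x) < e"
  obtains \<nu> where "(\<lambda>k. seminorm (S k)) \<longlonglongrightarrow> \<nu>" "(\<lambda>k. form (S k) (S k)) \<longlonglongrightarrow> \<nu>\<^sup>2"
proof -
  have le: "seminorm (S i) \<le> seminorm (\<lambda>x. S i x - S j x) + seminorm (S j)" for i j
    using seminorm_triangle[OF test_functions_diff[OF S S] S, of i j j] by simp
  have "Cauchy (\<lambda>k. seminorm (S k))"
  proof (rule metric_CauchyI)
    fix e :: real assume "e > 0"
    then obtain N where N: "\<And>i j. i \<ge> N \<Longrightarrow> j \<ge> N \<Longrightarrow> seminorm (\<lambda>x. S i x - S j x) < e"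
      using Cauchy by meson
    have "dist (seminorm (S i)) (seminorm (S j)) < e" if "i \<ge> N" "j \<ge> N" for i j
      using le[of i j] le[of j i] N[OF that] N[OF that(2,1)] by (simp add: dist_real_def)
    then show "\<exists>N. \<forall>i\<ge>N. \<forall>j\<ge>N. dist (seminorm (S i)) (seminorm (S j)) < e" by blast
  qed
  then obtain \<nu> where \<nu>: "(\<lambda>k. seminorm (S k)) \<longlonglongrightarrow> \<nu>"
    using Cauchy_convergent convergent_def by blast
  moreover have "(\<lambda>k. form (S k) (S k)) \<longlonglongrightarrow> \<nu>\<^sup>2"
    using tendsto_power[OF \<nu>, of 2] form_nonneg[OF S] by simp
  ultimately show thesis by (rule that)
qed

text \<open>Write \<open>S = R - P\<close> and \<open>T = R - Q\<close>, where the seminorms of \<open>P\<close> and \<open>Q\<close> tend to zero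
  and those of \<open>R\<close> stay bounded. By the Cauchy--Schwarz inequality all terms of the expanded
  \<open>form S T\<close> except \<open>form R R\<close> tend to zero.\<close>

lemma form_limit_invariant:
  assumes R: "\<And>k. R k \<in> test_functions \<Omega>" and S: "\<And>k. S k \<in> test_functions \<Omega>"
    and T: "\<And>k. T k \<in> test_functions \<Omega>"
    and bounded: "(\<lambda>k. seminorm (R k)) \<longlonglongrightarrow> \<nu>" and lim: "(\<lambda>k. form (R k) (R k)) \<longlonglongrightarrow> l"
    and RS: "(\<lambda>k. seminorm (\<lambda>x. R k x - S k x)) \<longlonglongrightarrow> 0"
    and RT: "(\<lambda>k. seminorm (\<lambda>x. R k x - T k x)) \<longlonglongrightarrow> 0"
  shows "(\<lambda>k. form (S k) (T k)) \<longlonglongrightarrow> l"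
proof -
  define P where "P k x = R k x - S k x" for k x
  define Q where "Q k x = R k x - T k x" for k x
  have P: "P k \<in> test_functions \<Omega>" and Q: "Q k \<in> test_functions \<Omega>" for k
    using test_functions_diff[OF R S] test_functions_diff[OF R T]
    by (simp_all add: P_def[abs_def] Q_def[abs_def])
  have vanish: "(\<lambda>k. form (X k) (Y k)) \<longlonglongrightarrow> 0"
    if X: "\<And>k. X k \<in> test_functions \<Omega>" and Y: "\<And>k. Y k \<in> test_functions \<Omega>"
      and lims: "(\<lambda>k. seminorm (X k)) \<longlonglongrightarrow> \<xi>" "(\<lambda>k. seminorm (Y k)) \<longlonglongrightarrow> \<eta>" "\<xi> * \<eta> = 0"
    for X Y :: "nat \<Rightarrow> 'a \<Rightarrow> 'b" and \<xi> \<eta>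
  proof (rule Lim_null_comparison)
    show "(\<lambda>k. seminorm (X k) * seminorm (Y k)) \<longlonglongrightarrow> 0"
      using tendsto_mult[OF lims(1,2)] lims(3) by simp
  qed (simp add: seminorm_Cauchy_Schwarz[OF X Y])
  have P0: "(\<lambda>k. seminorm (P k)) \<longlonglongrightarrow> 0" and Q0: "(\<lambda>k. seminorm (Q k)) \<longlonglongrightarrow> 0"
    using RS RT by (simp_all add: P_def[abs_def] Q_def[abs_def])
  have "form (R k) (R k) = form (S k) (T k) + form (R k) (Q k) + form (P k) (R k) - form (P k) (Q k)" for k
  proof -
    have SP: "R k = (\<lambda>x. S k x + P k x)" and TQ: "R k = (\<lambda>x. T k x + Q k x)"
      by (simp_all add: P_def Q_def)
    have "form (R k) (R k) = form (R k) (T k) + form (R k) (Q k)"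
      using form_add_right[OF R T Q] TQ by metis
    moreover have "form (R k) (T k) = form (S k) (T k) + form (P k) (T k)"
      using form_add_left[OF S P T] SP by metis
    moreover have "form (P k) (R k) = form (P k) (T k) + form (P k) (Q k)"
      using form_add_right[OF P T Q] TQ by metis
    ultimately show ?thesis by simp
  qed
  then have "form (S k) (T k) = form (R k) (R k) - form (R k) (Q k) - form (P k) (R k) + form (P k) (Q k)" for k
    by (simp add: algebra_simps)
  moreover have "(\<lambda>k. form (R k) (R k) - form (R k) (Q k) - form (P k) (R k) + form (P k) (Q k))
      \<longlonglongrightarrow> l - 0 - 0 + 0"
    by (intro tendsto_intros lim vanish[OF R Q bounded Q0] vanish[OF P R P0 bounded] vanish[OF P Q P0 Q0])
       simp_all
  ultimately show ?thesis by simp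
qed

text \<open>A derivative passes from one argument to the other: integrating by parts puts it on the first variable
  of \<open>A\<close>, where it equals \<open>\<gamma>\<close> times the derivative in the second variable, and integrating by parts
  back puts it on \<open>G\<close>. The two signs cancel.\<close>

lemma form_directional_derivative_swap:
  fixes F G :: "'a \<Rightarrow> 'b::euclidean_space"
  assumes D: "weak_partial_derivative (\<Omega> \<times> \<Omega>) (e, 0) A D"
    and D': "weak_partial_derivative (\<Omega> \<times> \<Omega>) (0, e) A D'"
    and ae: "AE z in lebesgue_on (\<Omega> \<times> \<Omega>). D z = \<gamma> * D' z"
    and F: "F \<in> test_functions \<Omega>" and G: "G \<in> test_functions \<Omega>"
  shows "form (\<lambda>x. frechet_derivative F (at x) e) G
       = \<gamma> * form F (\<lambda>x. frechet_derivative G (at x) e)"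
proof -
  let ?U = "\<Omega> \<times> \<Omega>"
  define \<Phi> where "\<Phi> z = F (fst z) \<bullet> G (snd z)" for z
  have \<Phi>: "\<Phi> \<in> test_functions ?U"
    unfolding \<Phi>_def[abs_def] by (rule test_functions_tensor[OF F G])
  have dF: "(\<lambda>x. frechet_derivative F (at x) e) \<in> test_functions \<Omega>"
    and dG: "(\<lambda>x. frechet_derivative G (at x) e) \<in> test_functions \<Omega>"
    by (rule test_functions_directional_derivative[OF F] test_functions_directional_derivative[OF G])+
  have zero: "frechet_derivative H (at x) 0 = 0" if "H \<in> test_functions \<Omega>" for H :: "'a \<Rightarrow> 'b" and x
    using linear_0[OF has_derivative_linear[OF C_diff_has_derivative[OF test_functions_C_diff[OF that, of "Suc 0"]]]] .
  have "form (\<lambda>x. frechet_derivative F (at x) e) G = (LINT z:?U|lebesgue. A z * frechet_derivative \<Phi> (at z) (e, 0))"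
    by (simp add: form_eq_integral[OF dF G] set_lebesgue_integral_def \<Phi>_def[abs_def]
        frechet_derivative_tensor[OF F G] zero[OF G])
  also have "\<dots> = - (LINT z:?U|lebesgue. D z * \<Phi> z)"
    using D \<Phi> by (auto simp: weak_partial_derivative_def)
  also have "(LINT z:?U|lebesgue. D z * \<Phi> z) = (LINT z|lebesgue. \<gamma> * (indicator ?U z * (D' z * \<Phi> z)))"
    unfolding set_lebesgue_integral_def real_scaleR_def
  proof (rule integral_cong_AE)
    have "integrable lebesgue (\<lambda>z. indicator ?U z * (D z * \<Phi> z))"
      "integrable lebesgue (\<lambda>z. indicator ?U z * (D' z * \<Phi> z))"
      using D D' integrable_locally_integrable_times_test[OF _ \<Phi>]
      by (auto simp: weak_partial_derivative_def)
    then show "(\<lambda>z. indicator ?U z * (D z * \<Phi> z)) \<in> borel_measurable lebesgue"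
      "(\<lambda>z. \<gamma> * (indicator ?U z * (D' z * \<Phi> z))) \<in> borel_measurable lebesgue"
      by (auto dest: borel_measurable_integrable)
    have "AE z in lebesgue. z \<in> ?U \<longrightarrow> D z = \<gamma> * D' z"
      using ae open_Times[OF open_domain open_domain]
      by (subst (asm) AE_restrict_space_iff) auto
    then show "AE z in lebesgue. indicator ?U z * (D z * \<Phi> z) = \<gamma> * (indicator ?U z * (D' z * \<Phi> z))"
      by eventually_elim (auto simp: indicator_def)
  qed
  also have "\<dots> = \<gamma> * (LINT z:?U|lebesgue. D' z * \<Phi> z)"
    by (simp add: set_lebesgue_integral_def)
  also have "(LINT z:?U|lebesgue. D' z * \<Phi> z) = - (LINT z:?U|lebesgue. A z * frechet_derivative \<Phi> (at z) (0, e))"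
    using D' \<Phi> by (auto simp: weak_partial_derivative_def)
  also have "(LINT z:?U|lebesgue. A z * frechet_derivative \<Phi> (at z) (0, e))
      = form F (\<lambda>x. frechet_derivative G (at x) e)"
    by (simp add: form_eq_integral[OF F dG] set_lebesgue_integral_def \<Phi>_def[abs_def]
        frechet_derivative_tensor[OF F G] zero[OF F])
  finally show ?thesis by simp
qed

end

section \<open>Gradient, strain and divergence of test fields\<close>

definition skew_gradient :: "(real^'n \<Rightarrow> real^'n) \<Rightarrow> real^'n \<Rightarrow> real^'n^'n" where
  "skew_gradient u x = (1/2) *\<^sub>R (grad u x - transpose (grad u x))"

definition divergence :: "(real^'n \<Rightarrow> real^'n) \<Rightarrow> real^'n \<Rightarrow> real" where
  "divergence u x = (\<Sum>i\<in>UNIV. grad u x $ i $ i)"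

lemma bounded_linear_transpose: "bounded_linear (transpose :: real^'n^'m \<Rightarrow> _)"
  by (auto simp: linear_conv_bounded_linear[symmetric] linear_iff transpose_def vec_eq_iff)

lemma inner_transpose: "transpose A \<bullet> transpose B = A \<bullet> (B :: real^'n^'m)"
  unfolding inner_vec_def transpose_def by (simp add: inner_vec_def) (rule sum.swap)

lemma grad_component: "grad u x $ i $ j = frechet_derivative u (at x) (axis j 1) $ i"
  by (simp add: grad_def matrix_def)

lemma frechet_derivative_component:
  fixes u :: "real^'n \<Rightarrow> real^'m"
  assumes "u \<in> test_functions U"
  shows "frechet_derivative (\<lambda>x. u x $ i) (at x) v = frechet_derivative u (at x) v $ i"
proof -
  have "((\<lambda>x. u x $ i) has_derivative (\<lambda>v. frechet_derivative u (at x) v $ i)) (at x)"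
    by (rule bounded_linear.has_derivative[OF bounded_linear_vec_nth
          C_diff_has_derivative[OF test_functions_C_diff[OF assms, of "Suc 0"]]])
  then show ?thesis
    by (simp flip: frechet_derivative_at)
qed

lemma test_functions_component:
  fixes u :: "'a::euclidean_space \<Rightarrow> ('b::real_normed_vector)^'m"
  shows "u \<in> test_functions U \<Longrightarrow> (\<lambda>x. u x $ i) \<in> test_functions U"
  by (rule test_functions_linear_image[OF bounded_linear_vec_nth])

lemma test_functions_grad:
  assumes u: "u \<in> test_functions U"
  shows "grad u \<in> test_functions U"
proof -
  (* L j places a vector in column j, so the gradient is the sum of its columns. *)
  define L :: "'a \<Rightarrow> real^'a \<Rightarrow> real^'a^'a" where "L j w = (\<chi> i k. if k = j then w $ i else 0)" for j w
  have L: "bounded_linear (L j)" for j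
    by (auto simp: linear_conv_bounded_linear[symmetric] linear_iff L_def vec_eq_iff)
  have "grad u = (\<lambda>x. \<Sum>j\<in>UNIV. L j (frechet_derivative u (at x) (axis j 1)))"
    by (simp add: fun_eq_iff vec_eq_iff grad_component L_def)
  then show ?thesis
    by (simp add: test_functions_sum test_functions_linear_image[OF L]
        test_functions_directional_derivative[OF u])
qed

lemma test_functions_transpose_grad:
  "u \<in> test_functions U \<Longrightarrow> (\<lambda>x. transpose (grad u x)) \<in> test_functions U"
  by (rule test_functions_linear_image[OF bounded_linear_transpose test_functions_grad])

lemma test_functions_strain:
  assumes "u \<in> test_functions U"
  shows "strain u \<in> test_functions U"
  unfolding strain_def[abs_def]
  by (intro test_functions_scaleR test_functions_add
      test_functions_grad test_functions_transpose_grad assms)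

lemma test_functions_skew_gradient:
  assumes "u \<in> test_functions U"
  shows "skew_gradient u \<in> test_functions U"
  unfolding skew_gradient_def[abs_def]
  by (intro test_functions_scaleR test_functions_diff
      test_functions_grad test_functions_transpose_grad assms)

lemma test_functions_divergence:
  assumes u: "u \<in> test_functions U"
  shows "divergence u \<in> test_functions U"
  unfolding divergence_def[abs_def]
  by (intro test_functions_sum test_functions_component
      test_functions_grad[OF u])

lemma grad_diff:
  assumes u: "u \<in> test_functions U" and v: "v \<in> test_functions U"
  shows "grad (\<lambda>x. u x - v x) = (\<lambda>x. grad u x - grad v x)"
proof -
  have "frechet_derivative (\<lambda>x. u x - v x) (at x) w
      = frechet_derivative u (at x) w - frechet_derivative v (at x) w" for x w
    by (simp flip: frechet_derivative_at[OF has_derivative_diff[OF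
          C_diff_has_derivative[OF test_functions_C_diff[OF u, of "Suc 0"]]
          C_diff_has_derivative[OF test_functions_C_diff[OF v, of "Suc 0"]]]])
  then show ?thesis
    by (simp add: fun_eq_iff vec_eq_iff grad_component)
qed

lemma strain_diff:
  assumes "u \<in> test_functions U" "v \<in> test_functions U"
  shows "strain (\<lambda>x. u x - v x) = (\<lambda>x. strain u x - strain v x)"
  by (simp add: fun_eq_iff vec_eq_iff strain_def transpose_def grad_diff[OF assms] field_simps)

lemma grad_form_eq: "grad_form \<Omega> A u v = kernel_form \<Omega> A (grad u) (grad v)"
  by (simp add: grad_form_def kernel_form_def)

lemma strain_form_eq: "strain_form \<Omega> A u v = kernel_form \<Omega> A (strain u) (strain v)"
  by (simp add: strain_form_def kernel_form_def)

section \<open>The non-local Korn inequality\<close>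

text \<open>Kernels on Cartesian space, where fields have a gradient matrix and a divergence.\<close>

locale positive_kernel_vec = positive_kernel \<Omega> A
  for \<Omega> :: "(real^'n) set" and A :: "(real^'n) \<times> (real^'n) \<Rightarrow> real"
begin

text \<open>The gradient is the sum of its symmetric and its skew part. These are orthogonal for the Frobenius
  product, even when taken at different points, so the form of the gradient splits into two nonnegative
  forms. The estimate is what lets the strain form be extended to the completion.\<close>

lemma strain_form_le_grad_form:
  assumes u: "u \<in> test_functions \<Omega>"
  shows "form (strain u) (strain u) \<le> form (grad u) (grad u)"
proof -
  note S = test_functions_strain[OF u] and W = test_functions_skew_gradient[OF u]
  (* Transposing both factors changes the sign of the product. *)
  have "strain u x \<bullet> skew_gradient u y = - (strain u x \<bullet> skew_gradient u y)" for x y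
  proof -
    have "strain u x \<bullet> skew_gradient u y = transpose (strain u x) \<bullet> transpose (skew_gradient u y)"
      by (simp add: inner_transpose)
    also have "transpose (strain u x) = strain u x"
      by (simp add: strain_def transpose_def vec_eq_iff)
    also have "transpose (skew_gradient u y) = - skew_gradient u y"
      by (simp add: skew_gradient_def transpose_def vec_eq_iff field_simps)
    finally show ?thesis by simp
  qed
  then have "strain u x \<bullet> skew_gradient u y = 0" for x y
    by (smt (verit))
  then have SW: "form (strain u) (skew_gradient u) = 0"
    by (simp add: kernel_form_def)
  have g: "grad u = (\<lambda>x. strain u x + skew_gradient u x)"
    by (simp add: fun_eq_iff strain_def skew_gradient_def vec_eq_iff field_simps)
  have "form (grad u) (grad u) = form (strain u) (strain u) + form (skew_gradient u) (skew_gradient u)"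
    unfolding g using SW form_sym[OF W S]
    by (simp add: form_add_left form_add_right S W test_functions_add)
  then show ?thesis
    using form_nonneg[OF W] by simp
qed

lemma two_strain_form_eq:
  assumes u: "u \<in> test_functions \<Omega>"
  shows "2 * form (strain u) (strain u)
       = form (grad u) (grad u) + form (grad u) (\<lambda>x. transpose (grad u x))"
proof -
  let ?g = "grad u" and ?t = "\<lambda>x. transpose (grad u x)"
  note g = test_functions_grad[OF u] and t = test_functions_transpose_grad[OF u]
  have gt: "(\<lambda>x. ?g x + ?t x) \<in> test_functions \<Omega>"
    by (rule test_functions_add[OF g t])
  have "4 * form (strain u) (strain u) = form (\<lambda>x. ?g x + ?t x) (\<lambda>x. ?g x + ?t x)"
    unfolding strain_def[abs_def]
    by (simp only: form_scaleR_left[OF gt test_functions_scaleR[OF gt]] form_scaleR_right[OF gt gt])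
  also have "\<dots> = form ?g ?g + 2 * form ?g ?t + form ?t ?t"
    using form_sym[OF t g] by (simp add: form_add_left form_add_right g t gt)
  also have "form ?t ?t = form ?g ?g"
    by (rule form_cong) (simp add: inner_transpose)
  finally show ?thesis by simp
qed

text \<open>In components, the left-hand side sums the forms of \<open>\<partial>\<^sub>j u\<^sub>i\<close> and \<open>\<partial>\<^sub>i u\<^sub>j\<close>. Moving \<open>\<partial>\<^sub>j\<close> to
  the second argument, commuting it with \<open>\<partial>\<^sub>i\<close> there and moving \<open>\<partial>\<^sub>i\<close> to the first argument gives the
  form of \<open>\<partial>\<^sub>i u\<^sub>i\<close> and \<open>\<partial>\<^sub>j u\<^sub>j\<close>.\<close>

lemma grad_transpose_form_eq_divergence_form:
  assumes swap: "\<And>k \<phi> \<psi>. \<phi> \<in> test_functions \<Omega> \<Longrightarrow> \<psi> \<in> test_functions \<Omega> \<Longrightarrow>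
      form (\<lambda>x. frechet_derivative \<phi> (at x) (axis k 1) :: real) \<psi>
      = \<gamma> * form \<phi> (\<lambda>x. frechet_derivative \<psi> (at x) (axis k 1))"
    and u: "u \<in> test_functions \<Omega>"
  shows "form (grad u) (\<lambda>x. transpose (grad u x)) = form (divergence u) (divergence u)"
proof -
  define D where "D j i x = grad u x $ i $ j" for j i x
  have D_eq: "D j i = (\<lambda>x. frechet_derivative (\<lambda>x. u x $ i) (at x) (axis j 1))" for i j
    by (simp add: D_def fun_eq_iff grad_component frechet_derivative_component[OF u])
  note ui = test_functions_component[OF u]
  have D: "D j i \<in> test_functions \<Omega>" for i j
    unfolding D_eq by (rule test_functions_directional_derivative[OF ui])
  note div = test_functions_divergence[OF u]
  have "form (grad u) (\<lambda>x. transpose (grad u x)) = (\<Sum>(i, j)\<in>UNIV. form (D j i) (D i j))"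
    unfolding case_prod_beta
    by (rule form_eq_sum[OF test_functions_grad[OF u] test_functions_transpose_grad[OF u] D D])
       (simp add: inner_vec_def D_def transpose_def sum.cartesian_product case_prod_beta)
  also have "\<dots> = (\<Sum>(i, j)\<in>UNIV. form (D i i) (D j j))"
  proof (rule sum.cong, simp, clarify)
    fix i j
    have second: "(\<lambda>x. frechet_derivative (D i j) (at x) (axis j 1))
        = (\<lambda>x. frechet_derivative (D j j) (at x) (axis i 1))"
      unfolding D_eq
      by (rule ext, rule mixed_second_derivatives_commute[OF test_functions_C_diff[OF ui]])
    have "form (D j i) (D i j) = \<gamma> * form (\<lambda>x. u x $ i) (\<lambda>x. frechet_derivative (D i j) (at x) (axis j 1))"
      unfolding D_eq[of j i] by (rule swap[OF ui D])
    also have "\<dots> = form (D i i) (D j j)"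
      unfolding second D_eq[of i i] by (rule swap[OF ui D, symmetric])
    finally show "form (D j i) (D i j) = form (D i i) (D j j)" .
  qed
  also have "\<dots> = form (divergence u) (divergence u)"
    unfolding case_prod_beta
    by (rule form_eq_sum[OF div div D D, symmetric])
       (simp add: divergence_def D_def sum_product sum.cartesian_product case_prod_beta)
  finally show ?thesis .
qed

text \<open>\<open>U\<close> is the class of \<open>s\<close> in the completion, and \<open>D\<close> stands for the gradient or the strain. As the
  form of \<open>D u\<close> is dominated by the norm of the completion, \<open>D\<close> maps Cauchy sequences to Cauchy
  sequences and null sequences to null sequences. Hence the limit exists and does not depend on the
  representatives, as the definite description in the extension requires.\<close>

lemma extend_form_limit:
  fixes D :: "(real^'n \<Rightarrow> real^'n) \<Rightarrow> real^'n \<Rightarrow> real^'n^'n"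
  assumes D: "\<And>u. u \<in> test_functions \<Omega> \<Longrightarrow> D u \<in> test_functions \<Omega>"
    and D_diff: "\<And>u v. u \<in> test_functions \<Omega> \<Longrightarrow> v \<in> test_functions \<Omega> \<Longrightarrow>
        D (\<lambda>x. u x - v x) = (\<lambda>x. D u x - D v x)"
    and D_le: "\<And>u. u \<in> test_functions \<Omega> \<Longrightarrow> form (D u) (D u) \<le> form (grad u) (grad u)"
    and s: "A_Cauchy \<Omega> A s"
    and U: "U = {t. A_Cauchy \<Omega> A s \<and> A_Cauchy \<Omega> A t \<and>
        (\<lambda>k. A_norm \<Omega> A (\<lambda>x. s k x - t k x)) \<longlonglongrightarrow> 0}"
  shows "(\<lambda>k. form (D (s k)) (D (s k))) \<longlonglongrightarrow> extend_form (\<lambda>u v. form (D u) (D v)) U U"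
proof -
  have test: "t k \<in> test_functions \<Omega>" if "A_Cauchy \<Omega> A t" for t k
    using that by (simp add: A_Cauchy_def)
  have le: "seminorm (\<lambda>x. D (t k) x - D (r l) x) \<le> A_norm \<Omega> A (\<lambda>x. t k x - r l x)"
    if "A_Cauchy \<Omega> A t" "A_Cauchy \<Omega> A r" for t r k l
    using D_le[OF test_functions_diff[OF test test], OF that]
    by (simp add: A_norm_def grad_form_eq D_diff[OF test test, OF that])
  obtain \<nu> where \<nu>: "(\<lambda>k. seminorm (D (s k))) \<longlonglongrightarrow> \<nu>"
      "(\<lambda>k. form (D (s k)) (D (s k))) \<longlonglongrightarrow> \<nu>\<^sup>2"
  proof (rule form_convergent[of "\<lambda>k. D (s k)"])
    fix e :: real assume "e > 0"
    then obtain N where "\<forall>i\<ge>N. \<forall>j\<ge>N. A_norm \<Omega> A (\<lambda>x. s i x - s j x) < e"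
      using s unfolding A_Cauchy_def by blast
    then show "\<exists>N. \<forall>i\<ge>N. \<forall>j\<ge>N. seminorm (\<lambda>x. D (s i) x - D (s j) x) < e"
      using le[OF s s] by (meson order.strict_trans1)
  qed (use D test[OF s] in auto)
  have near: "(\<lambda>k. seminorm (\<lambda>x. D (s k) x - D (t k) x)) \<longlonglongrightarrow> 0" if "t \<in> U" for t
  proof (rule Lim_null_comparison)
    show "(\<lambda>k. A_norm \<Omega> A (\<lambda>x. s k x - t k x)) \<longlonglongrightarrow> 0"
      using that by (simp add: U)
    have t: "A_Cauchy \<Omega> A t"
      using that by (simp add: U)
    have "form (\<lambda>x. D (s k) x - D (t k) x) (\<lambda>x. D (s k) x - D (t k) x) \<ge> 0" for k
      by (intro form_nonneg test_functions_diff D test s t)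
    then show "\<forall>\<^sub>F k in sequentially. norm (seminorm (\<lambda>x. D (s k) x - D (t k) x))
        \<le> A_norm \<Omega> A (\<lambda>x. s k x - t k x)"
      using le[OF s t] by simp
  qed
  have lim: "(\<lambda>k. form (D (r k)) (D (t k))) \<longlonglongrightarrow> \<nu>\<^sup>2" if "r \<in> U" "t \<in> U" for r t
    using that
    by (intro form_limit_invariant[OF _ _ _ \<nu> near near] D test s) (auto simp: U)
  have "grad (\<lambda>x. 0) x = (0 :: real^'n^'n)" for x
    by (simp add: vec_eq_iff grad_component)
  then have "s \<in> U"
    using s by (simp add: U A_norm_def grad_form_def)
  have "extend_form (\<lambda>u v. form (D u) (D v)) U U = \<nu>\<^sup>2"
    unfolding extend_form_def
  proof (rule the_equality)
    fix l assume "\<forall>s\<in>U. \<forall>t\<in>U. (\<lambda>k. form (D (s k)) (D (t k))) \<longlonglongrightarrow> l"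
    then show "l = \<nu>\<^sup>2"
      using \<open>s \<in> U\<close> \<nu>(2) LIMSEQ_unique by blast
  qed (use lim in blast)
  then show ?thesis using \<nu>(2) by simp
qed

end

theorem lemma8:
  fixes \<Omega> :: "(real^'n) set"
    and A :: "(real^'n) \<times> (real^'n) \<Rightarrow> real"
    and DA DA' :: "'n \<Rightarrow> (real^'n) \<times> (real^'n) \<Rightarrow> real"
    and \<gamma> :: real
  assumes "CARD('n) \<in> {2, 3}"
    and "bounded \<Omega>" "open \<Omega>" "connected \<Omega>" "lipschitz_boundary \<Omega>"
    and "square_integrable_on A (\<Omega> \<times> \<Omega>)"
    and "symmetric_kernel \<Omega> A"
    and "strictly_positive_definite \<Omega> A"
    and "\<And>k. weak_partial_derivative (\<Omega> \<times> \<Omega>) (axis k 1, 0) A (DA k)"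
    and "\<And>k. weak_partial_derivative (\<Omega> \<times> \<Omega>) (0, axis k 1) A (DA' k)"
    and "\<gamma>\<^sup>2 = 1"
    and "\<And>k. AE z in lebesgue_on (\<Omega> \<times> \<Omega>). DA k z = \<gamma> * DA' k z"
  shows "\<forall>u\<in>V_space \<Omega> A.
           2 * extend_form (strain_form \<Omega> A) u u \<ge> extend_form (grad_form \<Omega> A) u u"
proof
  fix U assume U: "U \<in> V_space \<Omega> A"
  have "locally_integrable_on A (\<Omega> \<times> \<Omega>)"
    using assms(9) by (simp add: weak_partial_derivative_def)
  then interpret positive_kernel_vec \<Omega> A
    using assms(3,7,8) by (simp add: positive_kernel_vec_def positive_kernel_def)
  have korn: "form (grad u) (grad u) \<le> 2 * form (strain u) (strain u)" if u: "u \<in> test_functions \<Omega>" for u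
  proof -
    have "form (grad u) (\<lambda>x. transpose (grad u x)) = form (divergence u) (divergence u)"
      by (rule grad_transpose_form_eq_divergence_form[OF
            form_directional_derivative_swap[OF assms(9,10,12)] u])
    then show ?thesis
      using two_strain_form_eq[OF u] form_nonneg[OF test_functions_divergence[OF u]]
      by simp
  qed
  from U obtain s where s: "A_Cauchy \<Omega> A s"
    and U_eq: "U = {t. A_Cauchy \<Omega> A s \<and> A_Cauchy \<Omega> A t \<and>
        (\<lambda>k. A_norm \<Omega> A (\<lambda>x. s k x - t k x)) \<longlonglongrightarrow> 0}"
    unfolding V_space_def quotient_def by auto
  have forms: "grad_form \<Omega> A = (\<lambda>u v. form (grad u) (grad v))"
    "strain_form \<Omega> A = (\<lambda>u v. form (strain u) (strain v))"
    by (simp_all add: fun_eq_iff grad_form_eq strain_form_eq)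
  have "(\<lambda>k. form (grad (s k)) (grad (s k))) \<longlonglongrightarrow> extend_form (grad_form \<Omega> A) U U"
    unfolding forms
    by (rule extend_form_limit[OF test_functions_grad grad_diff order.refl s U_eq])
  moreover have "(\<lambda>k. 2 * form (strain (s k)) (strain (s k))) \<longlonglongrightarrow> 2 * extend_form (strain_form \<Omega> A) U U"
    unfolding forms
    by (intro tendsto_mult tendsto_const
        extend_form_limit[OF test_functions_strain strain_diff strain_form_le_grad_form s U_eq])
  moreover have "form (grad (s k)) (grad (s k)) \<le> 2 * form (strain (s k)) (strain (s k))" for k
    using s by (intro korn) (simp add: A_Cauchy_def)
  ultimately show "extend_form (grad_form \<Omega> A) U U \<le> 2 * extend_form (strain_form \<Omega> A) U U"
    by (blast intro: LIMSEQ_le)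
qed

end
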